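(* Let $\varepsilon$ be a compact symmetric neighborhood of the diagonal of $S^2$. Let $\varphi(x;z;X)$ be an $\mathcal F_{\mathsf X}$-formula, with $x,z$ tuples of variables of sort $\mathsf H$, and let $\mathcal D\subseteq\mathcal U^z\times K(S)^{|X|}$. Assume that $\varphi(x;z;X)$ is $\varepsilon$-stable and that $\mathcal D$ is approximable by $\varphi(x;z;X)$. Then there are $k,m<\omega$ and $\langle a_{i,j} : i<k,\ j<m\rangle$ in $\mathcal U^x$ such that for every $b\in\mathcal U^z$ and every $C\in K(S)^{|X|}$ 1. $\displaystyle \langle b,C\rangle\in\mathcal D\ \Rightarrow\ \bigvee_{i<k}\ \bigwedge_{j<m}\ \varphi(a_{i,j};b;C^\varepsilon)$; 2. $\displaystyle \bigvee_{i<k}\ \bigwedge_{j<m}\ \varphi(a_{i,j};b;C)\ \Rightarrow\ \langle b,C^\varepsilon\rangle\in\mathcal D$.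
   Context: **Standard structures.** $S$ is a compact Hausdorff space and $K(S)$ is the set of its compact subsets. $\mathcal L_{\mathsf S}$ is the first-order language with a relation symbol for each compact $C\subseteq S$ (written $x\in C$) and a function symbol for each continuous $f:S^n\to S$; these are interpreted naturally in $S$. $\mathcal L_{\mathsf H}$ is an arbitrary first-order language. $\mathcal L$ is a two-sorted language, with sorts $\mathsf H$ (home sort) and $\mathsf S$, expanding $\mathcal L_{\mathsf H}$ and $\mathcal L_{\mathsf S}$ with function symbols of sort $\mathsf H^n\times\mathsf S^m\to\mathsf S$. A standard structure is a two-sorted $\mathcal L$-structure $\langle M,S\rangle$, with $M$ an $\mathcal L_{\mathsf H}$-structure, in which the symbols of sort $\mathsf H^n\times\mathsf S^m\to\mathsf S$ are interpreted by equicontinuous functions (the maps $S^m\to S$ obtained by fixing the $\mathsf H$-arguments are continuous uniformly in those arguments). It is denoted simply by $M$. **Formulas.** $\mathcal F$ is the set of $\mathcal L$-formulas built using $\wedge,\vee$ and the quantifiers $\forall,\exists$ of sort $\mathsf H$ and of sort $\mathsf S$ from: (i) atomic and negated atomic formulas of $\mathcal L_{\mathsf H}$; (ii) formulas $\tau\in C$, with $\tau$ a term of sort $\mathsf H^n\times\mathsf S^m\to\mathsf S$ and $C\subseteq S$ compact. $\mathcal F_{\mathsf X}$ is defined in the same way, but replacing (ii) by $\tau\in X$ with $X$ a variable of a new sort $\mathsf X$. For $\varphi(x;z;X)\in\mathcal F_{\mathsf X}$, with $X=X_1,\dots,X_n$ a tuple of variables of sort $\mathsf X$, and $C=C_1,\dots,C_n$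 a tuple of compact subsets of $S$, $\varphi(x;z;C)\in\mathcal F$ is obtained by replacing $X_i$ by $C_i$. The pseudonegation $\mathord{\sim}\varphi$ of $\varphi\in\mathcal F_{\mathsf X}$ is obtained by replacing the atomic (or negated atomic) formulas of $\mathcal L_{\mathsf H}$ by their negations and $\wedge,\vee,\forall,\exists$ by $\vee,\wedge,\exists,\forall$ respectively, leaving the formulas $\tau\in X$ unchanged. $\mathcal F(A)$ denotes formulas with parameters in $A$. **The structure $\mathcal U$.** A standard structure $M$ is $\mathcal F$-saturated if it realizes every type $p(x;\xi)\subseteq\mathcal F(A)$ ($x$ of sort $\mathsf H$, $\xi$ of sort $\mathsf S$), for any $A\subseteq M$ of cardinality smaller than $|M|$, that is finitely consistent in $M$. Fix an $\mathcal F$-saturated standard structure $\mathcal U$ of cardinality $\kappa$, where $\kappa$ is a Ramsey cardinal larger than the cardinality of the language. Small means of cardinality $<\kappa$. Truth of formulas is evaluated in $\mathcal U$. $\mathcal U^x$ is the set of tuples of elements of $\mathcal U$ matching $x$. **The sets $C^\varepsilon$.** For $\varepsilon$ a compact symmetric neighborhood of the diagonal of $S^2$ and $C\subseteq S$, $C^\varepsilon=\{\alpha\in S : \langle\xi,\alpha\rangle\in\varepsilon\text{ for some }\xi\in C\}$; for tuples $C$ this applies componentwise. For tuples, $\tilde C\cap C=\varnothing$ is read componentwise (all components are disjoint). **$\varepsilon$-stability.** $\varphi(x;z;X)$ is $\varepsilon$-unstable if for every $m<\omega$ there is a sequence $\langle a_i;b_i;C_i;\tilde C_i : i<m\rangle$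 (with $a_i\in\mathcal U^x$, $b_i\in\mathcal U^z$, $C_i,\tilde C_i\in K(S)^{|X|}$) such that for every $i<n<m$ $$\varphi(a_n;b_i;C_i)\ \wedge\ \mathord{\sim}\varphi(a_i;b_n;\tilde C_n)\quad\text{and}\quad C_i^\varepsilon\cap\tilde C_i=\varnothing.$$ It is $\varepsilon$-stable if it is not $\varepsilon$-unstable. **Approximability.** $\mathcal D\subseteq\mathcal U^z\times K(S)^{|X|}$ is approximable by $\varphi(x;z;X)$ if for every small set $B\subseteq\mathcal U^z$ there is an $a\in\mathcal U^x$ such that for every $b\in B$ and every $C\in K(S)^{|X|}$: $\langle b,C\rangle\in\mathcal D$ if and only if $\varphi(a;b;C)$. *)

theory Defs
  imports "HOL-Analysis.Analysis"
begin

unbundle cardinal_syntax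

text \<open>The compact Hausdorff space \<open>S\<close> is the universe of a type \<open>'s\<close>, the home sort of a structure
  is the universe of a type \<open>'h\<close>. A point of \<open>S\<^sup>n\<close> is an extensional function on \<open>{..<n}\<close>, so that
  the product topology of the library applies; tuples of the home sort are lists.\<close>

abbreviation S_pow :: "nat \<Rightarrow> (nat \<Rightarrow> 's::topological_space) topology" where
  "S_pow n \<equiv> product_topology (\<lambda>_. euclidean) {..<n}"

definition point :: "'s list \<Rightarrow> nat \<Rightarrow> 's" where
  "point xs = restrict ((!) xs) {..<length xs}"

definition tuples :: "nat \<Rightarrow> 'h list set" where
  "tuples n = {a. length a = n}"

definition compact_tuples :: "nat \<Rightarrow> 's::topological_space set list set" where
  "compact_tuples n = {Cs. length Cs = n \<and> (\<forall>C\<in>set Cs. compact C)}"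

subsection \<open>Languages and structures\<close>

text \<open>The symbols are kept in sets, as any of the three families may be empty. The symbols of sort
  \<open>H\<^sup>n \<times> S\<^sup>m \<rightarrow> S\<close> are \<open>mix_funs\<close>, with \<open>(n, m)\<close> given by \<open>mix_arity\<close>. The language of \<open>S\<close> is not part
  of the record because it is determined by \<open>'s\<close>.\<close>

record ('f, 'r, 'g) language =
  home_funs :: "'f set"
  home_rels :: "'r set"
  mix_funs :: "'g set"
  fun_arity :: "'f \<Rightarrow> nat"
  rel_arity :: "'r \<Rightarrow> nat"
  mix_arity :: "'g \<Rightarrow> nat \<times> nat"

text \<open>Extensionality makes distinct symbols denote distinct functions, so that the cardinality of the
  language is not inflated.\<close>

definition cont_symbols :: "(nat \<times> ((nat \<Rightarrow> 's::topological_space) \<Rightarrow> 's)) set" where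
  "cont_symbols = {(n, f). continuous_map (S_pow n) euclidean f \<and> f \<in> extensional (topspace (S_pow n))}"

definition symbols ::
  "('f, 'r, 'g) language \<Rightarrow>
    ('f + 'r + 'g + 's::topological_space set + nat \<times> ((nat \<Rightarrow> 's) \<Rightarrow> 's)) set" where
  "symbols L = home_funs L <+> home_rels L <+> mix_funs L <+> {C. compact C} <+> cont_symbols"

record ('f, 'r, 'g, 'h, 's) two_sorted =
  fun_interp :: "'f \<Rightarrow> 'h list \<Rightarrow> 'h"
  rel_interp :: "'r \<Rightarrow> 'h list \<Rightarrow> bool"
  mix_interp :: "'g \<Rightarrow> 'h list \<Rightarrow> (nat \<Rightarrow> 's) \<Rightarrow> 's"

text \<open>On a compact Hausdorff space the neighbourhoods of the diagonal are the entourages of the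
  unique compatible uniformity.\<close>

definition equicontinuous ::
  "nat \<Rightarrow> nat \<Rightarrow> ('h list \<Rightarrow> (nat \<Rightarrow> 's::topological_space) \<Rightarrow> 's) \<Rightarrow> bool" where
  "equicontinuous n m F \<longleftrightarrow>
    (\<forall>\<alpha>\<in>topspace (S_pow m). \<forall>E. Id \<subseteq> interior E \<longrightarrow>
      (\<exists>V. openin (S_pow m) V \<and> \<alpha> \<in> V \<and> (\<forall>h\<in>tuples n. \<forall>\<beta>\<in>V. (F h \<alpha>, F h \<beta>) \<in> E)))"

definition standard_structure ::
  "('f, 'r, 'g) language \<Rightarrow> ('f, 'r, 'g, 'h, 's::topological_space) two_sorted \<Rightarrow> bool" where
  "standard_structure L M \<longleftrightarrow>
    (\<forall>g\<in>mix_funs L. equicontinuous (fst (mix_arity L g)) (snd (mix_arity L g)) (mix_interp M g))"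

subsection \<open>Terms and formulas\<close>

text \<open>Elements of the home sort occur in terms as parameters.\<close>

datatype (dead 'f, hterm_params: 'h) hterm =
    HVar nat
  | HParam 'h
  | HFun 'f "('f, 'h) hterm list"

datatype (dead 'f, dead 'g, sterm_params: 'h, dead 's) sterm =
    SVar nat
  | SCont "nat \<times> ((nat \<Rightarrow> 's) \<Rightarrow> 's)" "('f, 'g, 'h, 's) sterm list"
  | SMix 'g "('f, 'h) hterm list" "('f, 'g, 'h, 's) sterm list"

datatype (dead 'f, dead 'r, atom_params: 'h) atom =
    Eq "('f, 'h) hterm" "('f, 'h) hterm"
  | Rel 'r "('f, 'h) hterm list"

text \<open>The type \<open>'c\<close> is what may stand on the right of \<open>\<tau> \<in> _\<close>: subsets of \<open>S\<close> for formulas in \<open>\<F>\<close>,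
  and indices of variables of sort \<open>X\<close> for formulas in \<open>\<F>\<^sub>X\<close>. Bound variables are named, with separate
  name spaces for the sorts \<open>H\<close> and \<open>S\<close>.\<close>

datatype (dead 'f, dead 'r, dead 'g, fm_params: 'h, dead 's, fm_sets: 'c) fm =
    Pos "('f, 'r, 'h) atom"
  | Neg "('f, 'r, 'h) atom"
  | Mem "('f, 'g, 'h, 's) sterm" 'c
  | And "('f, 'r, 'g, 'h, 's, 'c) fm" "('f, 'r, 'g, 'h, 's, 'c) fm"
  | Or "('f, 'r, 'g, 'h, 's, 'c) fm" "('f, 'r, 'g, 'h, 's, 'c) fm"
  | AllH nat "('f, 'r, 'g, 'h, 's, 'c) fm"
  | ExH nat "('f, 'r, 'g, 'h, 's, 'c) fm"
  | AllS nat "('f, 'r, 'g, 'h, 's, 'c) fm"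
  | ExS nat "('f, 'r, 'g, 'h, 's, 'c) fm"

fun wf_hterm :: "('f, 'r, 'g) language \<Rightarrow> ('f, 'h) hterm \<Rightarrow> bool" where
  "wf_hterm L (HVar i) \<longleftrightarrow> True"
| "wf_hterm L (HParam a) \<longleftrightarrow> True"
| "wf_hterm L (HFun f ts) \<longleftrightarrow>
    f \<in> home_funs L \<and> length ts = fun_arity L f \<and> (\<forall>t\<in>set ts. wf_hterm L t)"

fun wf_sterm ::
  "('f, 'r, 'g) language \<Rightarrow> ('f, 'g, 'h, 's::topological_space) sterm \<Rightarrow> bool" where
  "wf_sterm L (SVar i) \<longleftrightarrow> True"
| "wf_sterm L (SCont c us) \<longleftrightarrow>
    c \<in> cont_symbols \<and> length us = fst c \<and> (\<forall>u\<in>set us. wf_sterm L u)"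
| "wf_sterm L (SMix g ts us) \<longleftrightarrow>
    g \<in> mix_funs L \<and> (length ts, length us) = mix_arity L g \<and>
    (\<forall>t\<in>set ts. wf_hterm L t) \<and> (\<forall>u\<in>set us. wf_sterm L u)"

fun wf_atom :: "('f, 'r, 'g) language \<Rightarrow> ('f, 'r, 'h) atom \<Rightarrow> bool" where
  "wf_atom L (Eq t t') \<longleftrightarrow> wf_hterm L t \<and> wf_hterm L t'"
| "wf_atom L (Rel r ts) \<longleftrightarrow>
    r \<in> home_rels L \<and> length ts = rel_arity L r \<and> (\<forall>t\<in>set ts. wf_hterm L t)"

fun wf_fm ::
  "('f, 'r, 'g) language \<Rightarrow> ('f, 'r, 'g, 'h, 's::topological_space, 'c) fm \<Rightarrow> bool" where
  "wf_fm L (Pos A) \<longleftrightarrow> wf_atom L A"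
| "wf_fm L (Neg A) \<longleftrightarrow> wf_atom L A"
| "wf_fm L (Mem t X) \<longleftrightarrow> wf_sterm L t"
| "wf_fm L (And \<phi> \<psi>) \<longleftrightarrow> wf_fm L \<phi> \<and> wf_fm L \<psi>"
| "wf_fm L (Or \<phi> \<psi>) \<longleftrightarrow> wf_fm L \<phi> \<and> wf_fm L \<psi>"
| "wf_fm L (AllH i \<phi>) \<longleftrightarrow> wf_fm L \<phi>"
| "wf_fm L (ExH i \<phi>) \<longleftrightarrow> wf_fm L \<phi>"
| "wf_fm L (AllS i \<phi>) \<longleftrightarrow> wf_fm L \<phi>"
| "wf_fm L (ExS i \<phi>) \<longleftrightarrow> wf_fm L \<phi>"

text \<open>\<open>\<F>(A)\<close>, and \<open>\<F>\<^sub>X(A)\<close> with \<open>n\<close> variables \<open>X\<^sub>0, \<dots>, X\<^sub>n\<^sub>-\<^sub>1\<close> of sort \<open>X\<close>.\<close>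

definition F_formulas ::
  "('f, 'r, 'g) language \<Rightarrow> 'h set \<Rightarrow> ('f, 'r, 'g, 'h, 's::topological_space, 's set) fm set" where
  "F_formulas L A = {\<phi>. wf_fm L \<phi> \<and> fm_params \<phi> \<subseteq> A \<and> (\<forall>C\<in>fm_sets \<phi>. compact C)}"

definition FX_formulas ::
  "('f, 'r, 'g) language \<Rightarrow> 'h set \<Rightarrow> nat \<Rightarrow> ('f, 'r, 'g, 'h, 's::topological_space, nat) fm set" where
  "FX_formulas L A n = {\<phi>. wf_fm L \<phi> \<and> fm_params \<phi> \<subseteq> A \<and> fm_sets \<phi> \<subseteq> {..<n}}"

definition inst ::
  "('f, 'r, 'g, 'h, 's, nat) fm \<Rightarrow> 's set list \<Rightarrow> ('f, 'r, 'g, 'h, 's, 's set) fm" where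
  "inst \<phi> Cs = map_fm id ((!) Cs) \<phi>"

fun pneg :: "('f, 'r, 'g, 'h, 's, 'c) fm \<Rightarrow> ('f, 'r, 'g, 'h, 's, 'c) fm" where
  "pneg (Pos A) = Neg A"
| "pneg (Neg A) = Pos A"
| "pneg (Mem t X) = Mem t X"
| "pneg (And \<phi> \<psi>) = Or (pneg \<phi>) (pneg \<psi>)"
| "pneg (Or \<phi> \<psi>) = And (pneg \<phi>) (pneg \<psi>)"
| "pneg (AllH i \<phi>) = ExH i (pneg \<phi>)"
| "pneg (ExH i \<phi>) = AllH i (pneg \<phi>)"
| "pneg (AllS i \<phi>) = ExS i (pneg \<phi>)"
| "pneg (ExS i \<phi>) = AllS i (pneg \<phi>)"

subsection \<open>Free variables of sort \<open>H\<close> and of sort \<open>S\<close>\<close>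

fun hvars_hterm :: "('f, 'h) hterm \<Rightarrow> nat set" where
  "hvars_hterm (HVar i) = {i}"
| "hvars_hterm (HParam a) = {}"
| "hvars_hterm (HFun f ts) = (\<Union>t\<in>set ts. hvars_hterm t)"

fun hvars_sterm :: "('f, 'g, 'h, 's) sterm \<Rightarrow> nat set" where
  "hvars_sterm (SVar i) = {}"
| "hvars_sterm (SCont c us) = (\<Union>u\<in>set us. hvars_sterm u)"
| "hvars_sterm (SMix g ts us) = (\<Union>t\<in>set ts. hvars_hterm t) \<union> (\<Union>u\<in>set us. hvars_sterm u)"

fun svars_sterm :: "('f, 'g, 'h, 's) sterm \<Rightarrow> nat set" where
  "svars_sterm (SVar i) = {i}"
| "svars_sterm (SCont c us) = (\<Union>u\<in>set us. svars_sterm u)"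
| "svars_sterm (SMix g ts us) = (\<Union>u\<in>set us. svars_sterm u)"

fun hvars_atom :: "('f, 'r, 'h) atom \<Rightarrow> nat set" where
  "hvars_atom (Eq t t') = hvars_hterm t \<union> hvars_hterm t'"
| "hvars_atom (Rel r ts) = (\<Union>t\<in>set ts. hvars_hterm t)"

fun hfv :: "('f, 'r, 'g, 'h, 's, 'c) fm \<Rightarrow> nat set" where
  "hfv (Pos A) = hvars_atom A"
| "hfv (Neg A) = hvars_atom A"
| "hfv (Mem t X) = hvars_sterm t"
| "hfv (And \<phi> \<psi>) = hfv \<phi> \<union> hfv \<psi>"
| "hfv (Or \<phi> \<psi>) = hfv \<phi> \<union> hfv \<psi>"
| "hfv (AllH i \<phi>) = hfv \<phi> - {i}"
| "hfv (ExH i \<phi>) = hfv \<phi> - {i}"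
| "hfv (AllS i \<phi>) = hfv \<phi>"
| "hfv (ExS i \<phi>) = hfv \<phi>"

fun sfv :: "('f, 'r, 'g, 'h, 's, 'c) fm \<Rightarrow> nat set" where
  "sfv (Pos A) = {}"
| "sfv (Neg A) = {}"
| "sfv (Mem t X) = svars_sterm t"
| "sfv (And \<phi> \<psi>) = sfv \<phi> \<union> sfv \<psi>"
| "sfv (Or \<phi> \<psi>) = sfv \<phi> \<union> sfv \<psi>"
| "sfv (AllH i \<phi>) = sfv \<phi>"
| "sfv (ExH i \<phi>) = sfv \<phi>"
| "sfv (AllS i \<phi>) = sfv \<phi> - {i}"
| "sfv (ExS i \<phi>) = sfv \<phi> - {i}"

subsection \<open>Truth\<close>

fun heval :: "('f, 'r, 'g, 'h, 's) two_sorted \<Rightarrow> (nat \<Rightarrow> 'h) \<Rightarrow> ('f, 'h) hterm \<Rightarrow> 'h" where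
  "heval M v (HVar i) = v i"
| "heval M v (HParam a) = a"
| "heval M v (HFun f ts) = fun_interp M f (map (heval M v) ts)"

fun seval ::
  "('f, 'r, 'g, 'h, 's) two_sorted \<Rightarrow> (nat \<Rightarrow> 'h) \<Rightarrow> (nat \<Rightarrow> 's) \<Rightarrow> ('f, 'g, 'h, 's) sterm \<Rightarrow> 's" where
  "seval M v e (SVar i) = e i"
| "seval M v e (SCont c us) = snd c (point (map (seval M v e) us))"
| "seval M v e (SMix g ts us) =
    mix_interp M g (map (heval M v) ts) (point (map (seval M v e) us))"

fun sat_atom :: "('f, 'r, 'g, 'h, 's) two_sorted \<Rightarrow> (nat \<Rightarrow> 'h) \<Rightarrow> ('f, 'r, 'h) atom \<Rightarrow> bool" where
  "sat_atom M v (Eq t t') \<longleftrightarrow> heval M v t = heval M v t'"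
| "sat_atom M v (Rel r ts) \<longleftrightarrow> rel_interp M r (map (heval M v) ts)"

fun sat ::
  "('f, 'r, 'g, 'h, 's) two_sorted \<Rightarrow> (nat \<Rightarrow> 'h) \<Rightarrow> (nat \<Rightarrow> 's) \<Rightarrow>
    ('f, 'r, 'g, 'h, 's, 's set) fm \<Rightarrow> bool" where
  "sat M v e (Pos A) \<longleftrightarrow> sat_atom M v A"
| "sat M v e (Neg A) \<longleftrightarrow> \<not> sat_atom M v A"
| "sat M v e (Mem t C) \<longleftrightarrow> seval M v e t \<in> C"
| "sat M v e (And \<phi> \<psi>) \<longleftrightarrow> sat M v e \<phi> \<and> sat M v e \<psi>"
| "sat M v e (Or \<phi> \<psi>) \<longleftrightarrow> sat M v e \<phi> \<or> sat M v e \<psi>"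
| "sat M v e (AllH i \<phi>) \<longleftrightarrow> (\<forall>a. sat M (v(i := a)) e \<phi>)"
| "sat M v e (ExH i \<phi>) \<longleftrightarrow> (\<exists>a. sat M (v(i := a)) e \<phi>)"
| "sat M v e (AllS i \<phi>) \<longleftrightarrow> (\<forall>\<alpha>. sat M v (e(i := \<alpha>)) \<phi>)"
| "sat M v e (ExS i \<phi>) \<longleftrightarrow> (\<exists>\<alpha>. sat M v (e(i := \<alpha>)) \<phi>)"

text \<open>\<open>holds M xs zs \<phi> a b Cs\<close> is the truth of \<open>\<phi>(a; b; C)\<close> in \<open>M\<close>, for \<open>\<phi>(x; z; X)\<close> without free variables
  of sort \<open>S\<close>, and with free variables of sort \<open>H\<close> in the tuples \<open>xs\<close> and \<open>zs\<close>.\<close>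

definition holds ::
  "('f, 'r, 'g, 'h, 's) two_sorted \<Rightarrow> nat list \<Rightarrow> nat list \<Rightarrow> ('f, 'r, 'g, 'h, 's, nat) fm \<Rightarrow>
    'h list \<Rightarrow> 'h list \<Rightarrow> 's set list \<Rightarrow> bool" where
  "holds M xs zs \<phi> a b Cs \<longleftrightarrow>
    sat M (\<lambda>i. the (map_of (zip (xs @ zs) (a @ b)) i)) (\<lambda>_. undefined) (inst \<phi> Cs)"

definition F_saturated ::
  "('f, 'r, 'g) language \<Rightarrow> ('f, 'r, 'g, 'h, 's::topological_space) two_sorted \<Rightarrow> bool" where
  "F_saturated L M \<longleftrightarrow>
    (\<forall>A p. |A| <o |UNIV :: 'h set| \<and> p \<subseteq> F_formulas L A \<and>
        finite (\<Union>\<phi>\<in>p. hfv \<phi>) \<and> finite (\<Union>\<phi>\<in>p. sfv \<phi>) \<and>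
        (\<forall>q\<subseteq>p. finite q \<longrightarrow> (\<exists>v e. \<forall>\<phi>\<in>q. sat M v e \<phi>)) \<longrightarrow>
      (\<exists>v e. \<forall>\<phi>\<in>p. sat M v e \<phi>))"

text \<open>\<open>\<kappa>\<close> is Ramsey if it is uncountable and \<open>\<kappa> \<rightarrow> (\<kappa>)\<close> holds for partitions of the finite subsets of
  \<open>\<kappa>\<close> into two classes; the colour of a subset of \<open>H\<close> may depend on its size.\<close>

definition ramsey_cardinal :: "'k rel \<Rightarrow> bool" where
  "ramsey_cardinal \<kappa> \<longleftrightarrow>
    Card_order \<kappa> \<and> natLeq <o \<kappa> \<and>
    (\<forall>f :: 'k set \<Rightarrow> bool. \<exists>H\<subseteq>Field \<kappa>. |H| =o \<kappa> \<and>
      (\<forall>n. \<exists>c. \<forall>s\<subseteq>H. finite s \<and> card s = n \<longrightarrow> f s = c))"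

subsection \<open>Stability and approximability\<close>

text \<open>\<open>C\<^sup>\<epsilon>\<close> is the relational image \<open>\<epsilon> `` C\<close>.\<close>

definition enlarge :: "('s \<times> 's) set \<Rightarrow> 's set list \<Rightarrow> 's set list" where
  "enlarge \<epsilon> Cs = map (\<lambda>C. \<epsilon> `` C) Cs"

definition disjoint_tuples :: "'s set list \<Rightarrow> 's set list \<Rightarrow> bool" where
  "disjoint_tuples Cs Ds \<longleftrightarrow> list_all2 (\<lambda>C D. C \<inter> D = {}) Cs Ds"

definition unstable ::
  "('f, 'r, 'g, 'h, 's::topological_space) two_sorted \<Rightarrow> nat list \<Rightarrow> nat list \<Rightarrow> nat \<Rightarrow>
    ('f, 'r, 'g, 'h, 's, nat) fm \<Rightarrow> ('s \<times> 's) set \<Rightarrow> bool" where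
  "unstable M xs zs N \<phi> \<epsilon> \<longleftrightarrow>
    (\<forall>m::nat. \<exists>(a :: nat \<Rightarrow> 'h list) (b :: nat \<Rightarrow> 'h list) (C :: nat \<Rightarrow> 's set list) C'.
      (\<forall>i<m. a i \<in> tuples (length xs) \<and> b i \<in> tuples (length zs) \<and>
        C i \<in> compact_tuples N \<and> C' i \<in> compact_tuples N) \<and>
      (\<forall>n<m. \<forall>i<n. holds M xs zs \<phi> (a n) (b i) (C i) \<and>
        holds M xs zs (pneg \<phi>) (a i) (b n) (C' n) \<and>
        disjoint_tuples (enlarge \<epsilon> (C i)) (C' i)))"

definition approximable ::
  "'k rel \<Rightarrow> ('f, 'r, 'g, 'h, 's::topological_space) two_sorted \<Rightarrow> nat list \<Rightarrow> nat list \<Rightarrow> nat \<Rightarrow>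
    ('f, 'r, 'g, 'h, 's, nat) fm \<Rightarrow> ('h list \<times> 's set list) set \<Rightarrow> bool" where
  "approximable \<kappa> M xs zs N \<phi> \<D> \<longleftrightarrow>
    (\<forall>B\<subseteq>tuples (length zs). |B| <o \<kappa> \<longrightarrow>
      (\<exists>a\<in>tuples (length xs). \<forall>b\<in>B. \<forall>C\<in>compact_tuples N.
        (b, C) \<in> \<D> \<longleftrightarrow> holds M xs zs \<phi> a b C))"

end

theory Submission
  imports Defs
begin

text \<open>
  The proof has a finite combinatorial half and a topological half, which meet in the notion of a
  ladder: sequences \<open>a\<^sub>i\<close>, \<open>y\<^sub>i = (b\<^sub>i, C\<^sub>i)\<close> such that for \<open>i < n\<close> the formula \<open>\<phi>(a\<^sub>n; b\<^sub>i; C\<^sub>i)\<close> is true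
  and \<open>\<phi>(a\<^sub>i; b\<^sub>n; C\<^sub>n\<^sup>\<epsilon>)\<close> is false.

  Combinatorial half. Suppose that no ladder has length \<open>m\<close>. Choose \<open>a\<^sub>0, a\<^sub>1, \<dots>\<close> in turn, as in the
  classical proof that types over a model are definable by positive Boolean combinations when the
  formula is stable. For every set \<open>W\<close> of earlier choices ask whether some \<open>(b, C)\<close> with \<open>(b, C\<^sup>\<epsilon>) \<notin> \<D>\<close>
  satisfies \<open>\<phi>(a; b; C)\<close> for all \<open>a \<in> W\<close>, and whether some \<open>(b, C) \<in> \<D>\<close> violates
  \<open>\<phi>(a; b; C\<^sup>\<epsilon>)\<close> for all \<open>a \<in> W\<close>; fix one such pair where there is one. Only finitely many pairs are
  fixed before stage \<open>n\<close>, so approximability yields an \<open>a\<^sub>n\<close> that rejects the enlargements of the pairs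
  of the first sort and accepts the pairs of the second sort. If a pair
  outside \<open>\<D>\<close>, even after enlarging its sets, were accepted by \<open>m\<close> of the \<open>a\<^sub>i\<close>, then the witnesses fixed
  for the initial segments of these \<open>m\<close> elements would form a ladder, and likewise for a pair in \<open>\<D>\<close>
  that \<open>m\<close> of them reject after enlarging. So a vote among \<open>a\<^sub>0, \<dots>, a\<^sub>2\<^sub>m\<^sub>-\<^sub>1\<close> decides \<open>\<D>\<close> up to \<open>\<epsilon>\<close>
  (\<open>majority_approximates\<close>), and the condition that at least \<open>m\<close> of them accept is a disjunction
  over the \<open>m\<close>-element sets of voters.

  Topological half. Ladders of all lengths make \<open>\<phi>\<close> \<open>\<epsilon>\<close>-unstable (\<open>unstable_if_ladders\<close>). Here the
  failure of \<open>\<phi>(a; b; C)\<close> must become the truth of \<open>\<sim>\<phi>(a; b; D)\<close> for compact \<open>D\<close> disjoint from \<open>C\<close>.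
  Saturation shows that \<open>\<phi>(a; b; C)\<close> already fails for compact neighbourhoods of the sets \<open>C\<close>
  (\<open>sat_if_sat_nbhds\<close>), and the closed complements of the interiors of these serve as \<open>D\<close>.
\<close>

section \<open>Free variables and truth\<close>

lemma finite_hvars_hterm: "finite (hvars_hterm t)"
  by (induction t) auto

lemma finite_hvars_sterm: "finite (hvars_sterm t)"
  by (induction t) (auto simp: finite_hvars_hterm)

lemma finite_svars_sterm: "finite (svars_sterm t)"
  by (induction t) auto

lemma finite_hvars_atom: "finite (hvars_atom A)"
  by (cases A) (auto simp: finite_hvars_hterm)

lemma finite_hfv: "finite (hfv \<phi>)"
  by (induction \<phi>) (auto simp: finite_hvars_atom finite_hvars_sterm)

lemma finite_sfv: "finite (sfv \<phi>)"
  by (induction \<phi>) (auto simp: finite_svars_sterm)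

lemma heval_cong: "(\<And>i. i \<in> hvars_hterm t \<Longrightarrow> v i = v' i) \<Longrightarrow> heval M v t = heval M v' t"
proof (induction t)
  case (HFun f ts)
  then have "map (heval M v) ts = map (heval M v') ts" by (intro map_cong) auto
  then show ?case by (simp only: heval.simps)
qed auto

lemma seval_cong:
  "(\<And>i. i \<in> hvars_sterm t \<Longrightarrow> v i = v' i) \<Longrightarrow> (\<And>i. i \<in> svars_sterm t \<Longrightarrow> e i = e' i) \<Longrightarrow>
    seval M v e t = seval M v' e' t"
proof (induction t)
  case (SCont c us)
  have "seval M v e u = seval M v' e' u" if "u \<in> set us" for u
  proof (rule SCont.IH[OF that])
    show "v i = v' i" if "i \<in> hvars_sterm u" for i
      using that \<open>u \<in> set us\<close> by (intro SCont.prems) auto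
    show "e i = e' i" if "i \<in> svars_sterm u" for i
      using that \<open>u \<in> set us\<close> by (intro SCont.prems) auto
  qed
  then have "map (seval M v e) us = map (seval M v' e') us" by simp
  then show ?case by (simp only: seval.simps)
next
  case (SMix g ts us)
  have "seval M v e u = seval M v' e' u" if "u \<in> set us" for u
  proof (rule SMix.IH[OF that])
    show "v i = v' i" if "i \<in> hvars_sterm u" for i
      using that \<open>u \<in> set us\<close> by (intro SMix.prems) auto
    show "e i = e' i" if "i \<in> svars_sterm u" for i
      using that \<open>u \<in> set us\<close> by (intro SMix.prems) auto
  qed
  then have "map (seval M v e) us = map (seval M v' e') us" by simp
  moreover have "map (heval M v) ts = map (heval M v') ts"
    using SMix.prems(1) by (intro map_cong heval_cong) auto
  ultimately show ?case by (simp only: seval.simps)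
qed auto

lemma sat_atom_cong:
  assumes "\<And>i. i \<in> hvars_atom A \<Longrightarrow> v i = v' i"
  shows "sat_atom M v A = sat_atom M v' A"
proof (cases A)
  case (Eq t t')
  then show ?thesis using assms heval_cong[of t v v' M] heval_cong[of t' v v' M] by auto
next
  case (Rel r ts)
  then have "map (heval M v) ts = map (heval M v') ts"
    using assms by (auto intro!: heval_cong)
  then show ?thesis using Rel by (simp only: sat_atom.simps)
qed

lemma sat_cong:
  "(\<And>i. i \<in> hfv \<phi> \<Longrightarrow> v i = v' i) \<Longrightarrow> (\<And>i. i \<in> sfv \<phi> \<Longrightarrow> e i = e' i) \<Longrightarrow>
    sat M v e \<phi> = sat M v' e' \<phi>"
proof (induction \<phi> arbitrary: v v' e e')
  case (Pos A)
  then show ?case using sat_atom_cong[of A v v' M] by simp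
next
  case (Neg A)
  then show ?case using sat_atom_cong[of A v v' M] by simp
next
  case (Mem t C)
  then show ?case using seval_cong[of t v v' e e' M] by simp
next
  case (And \<phi> \<psi>)
  show ?case using And.IH[of v v' e e'] And.prems by auto
next
  case (Or \<phi> \<psi>)
  show ?case using Or.IH[of v v' e e'] Or.prems by auto
next
  case (AllH i \<phi>)
  have "sat M (v(i := a)) e \<phi> = sat M (v'(i := a)) e' \<phi>" for a
    using AllH.prems by (intro AllH.IH) auto
  then show ?case by simp
next
  case (ExH i \<phi>)
  have "sat M (v(i := a)) e \<phi> = sat M (v'(i := a)) e' \<phi>" for a
    using ExH.prems by (intro ExH.IH) auto
  then show ?case by simp
next
  case (AllS i \<phi>)
  have "sat M v (e(i := a)) \<phi> = sat M v' (e'(i := a)) \<phi>" for a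
    using AllS.prems by (intro AllS.IH) auto
  then show ?case by simp
next
  case (ExS i \<phi>)
  have "sat M v (e(i := a)) \<phi> = sat M v' (e'(i := a)) \<phi>" for a
    using ExS.prems by (intro ExS.IH) auto
  then show ?case by simp
qed

section \<open>Sets in place of the variables of sort X\<close>

text \<open>The same substitution as \<open>inst\<close>, with a function in place of a list, so that families of
  neighbourhoods can be handled without carrying lengths through inductions.\<close>

definition subst_sets ::
  "(nat \<Rightarrow> 's set) \<Rightarrow> ('f, 'r, 'g, 'h, 's, nat) fm \<Rightarrow> ('f, 'r, 'g, 'h, 's, 's set) fm" where
  "subst_sets G \<phi> = map_fm id G \<phi>"

lemma subst_sets_simps [simp]:
  "subst_sets G (Pos A) = Pos A"
  "subst_sets G (Neg A) = Neg A"
  "subst_sets G (Mem t i) = Mem t (G i)"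
  "subst_sets G (And \<phi> \<psi>) = And (subst_sets G \<phi>) (subst_sets G \<psi>)"
  "subst_sets G (Or \<phi> \<psi>) = Or (subst_sets G \<phi>) (subst_sets G \<psi>)"
  "subst_sets G (AllH k \<phi>) = AllH k (subst_sets G \<phi>)"
  "subst_sets G (ExH k \<phi>) = ExH k (subst_sets G \<phi>)"
  "subst_sets G (AllS k \<phi>) = AllS k (subst_sets G \<phi>)"
  "subst_sets G (ExS k \<phi>) = ExS k (subst_sets G \<phi>)"
  by (simp_all add: subst_sets_def id_def atom.map_ident sterm.map_ident)

lemma subst_sets_preserves [simp]:
  "hfv (subst_sets G \<phi>) = hfv \<phi>"
  "sfv (subst_sets G \<phi>) = sfv \<phi>"
  "wf_fm L (subst_sets G \<phi>) = wf_fm L \<phi>"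
  by (induction \<phi>) auto

lemma fm_params_subst_sets [simp]: "fm_params (subst_sets G \<phi>) = fm_params \<phi>"
  by (simp add: subst_sets_def fm.set_map)

lemma fm_sets_subst_sets [simp]: "fm_sets (subst_sets G \<phi>) = G ` fm_sets \<phi>"
  by (simp add: subst_sets_def fm.set_map)

lemma inst_eq: "inst \<phi> Cs = subst_sets ((!) Cs) \<phi>"
  by (simp add: inst_def subst_sets_def)

lemma sat_mono:
  "(\<And>i. i \<in> fm_sets \<phi> \<Longrightarrow> G i \<subseteq> G' i) \<Longrightarrow> sat M v e (subst_sets G \<phi>) \<Longrightarrow>
    sat M v e (subst_sets G' \<phi>)"
proof (induction \<phi> arbitrary: v e)
  case (ExH i \<phi>)
  then show ?case by simp blast
next
  case (ExS i \<phi>)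
  then show ?case by simp blast
next
  case (Mem t X)
  then show ?case by auto
qed auto

text \<open>Where \<open>\<tau>\<close> misses \<open>G\<^sub>i\<close> it lies in \<open>H\<^sub>i\<close>, while the connectives and quantifiers are dualised, so
  pushing the negation inwards turns falsity over \<open>G\<close> into \<open>\<sim>\<phi>\<close> over \<open>H\<close>.\<close>

lemma sat_pneg_if_covers:
  "(\<And>i. i \<in> fm_sets \<phi> \<Longrightarrow> G i \<union> H i = UNIV) \<Longrightarrow> \<not> sat M v e (subst_sets G \<phi>) \<Longrightarrow>
    sat M v e (subst_sets H (pneg \<phi>))"
proof (induction \<phi> arbitrary: v e)
  case (AllH i \<phi>)
  then show ?case by simp blast
next
  case (AllS i \<phi>)
  then show ?case by simp blast
next
  case (Mem t X)
  then show ?case by auto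
qed auto

lemma fm_sets_pneg [simp]: "fm_sets (pneg \<phi>) = fm_sets \<phi>"
  by (induction \<phi>) auto

section \<open>Truth is reflected from compact neighbourhoods\<close>

definition nbhd_family :: "nat set \<Rightarrow> (nat \<Rightarrow> 's::topological_space set) \<Rightarrow> (nat \<Rightarrow> 's set) \<Rightarrow> bool" where
  "nbhd_family I G G' \<longleftrightarrow> (\<forall>i\<in>I. compact (G' i) \<and> G i \<subseteq> interior (G' i))"

lemma nbhd_family_Inter:
  fixes G :: "nat \<Rightarrow> 's::t2_space set"
  assumes "compact (UNIV :: 's set)" "finite Q" "\<And>G'. G' \<in> Q \<Longrightarrow> nbhd_family I G G'"
  shows "nbhd_family I G (\<lambda>i. \<Inter>G'\<in>Q. G' i)"
proof -
  have "compact (\<Inter>G'\<in>Q. G' i)" if "i \<in> I" for i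
  proof -
    have "closed (\<Inter>G'\<in>Q. G' i)"
      using assms(3) that unfolding nbhd_family_def by (intro closed_INT) (blast intro: compact_imp_closed)
    then show ?thesis using compact_Int_closed[OF assms(1)] by simp
  qed
  moreover have "G i \<subseteq> interior (\<Inter>G'\<in>Q. G' i)" if "i \<in> I" for i
  proof -
    have "open (\<Inter>G'\<in>Q. interior (G' i))" using assms(2) by auto
    moreover have "G i \<subseteq> (\<Inter>G'\<in>Q. interior (G' i))"
      using assms(3) that unfolding nbhd_family_def by blast
    moreover have "(\<Inter>G'\<in>Q. interior (G' i)) \<subseteq> (\<Inter>G'\<in>Q. G' i)"
      using interior_subset by blast
    ultimately show ?thesis by (meson interior_maximal order_trans)
  qed
  ultimately show ?thesis unfolding nbhd_family_def by blast
qed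

lemma compact_nbhd_avoiding_point:
  fixes C :: "'s::t2_space set"
  assumes "compact (UNIV :: 's set)" "compact C" "x \<notin> C"
  obtains K where "compact K" "C \<subseteq> interior K" "x \<notin> K"
proof -
  have "Hausdorff_space (euclidean :: 's topology)"
    using hausdorff[where 'a = 's] unfolding Hausdorff_space_def disjnt_def open_openin[symmetric]
    by metis
  then obtain V W where VW: "open V" "open W" "x \<in> V" "C \<subseteq> W" "V \<inter> W = {}"
    using Hausdorff_space_compact_separation[of "euclidean :: 's topology" "{x}" C] assms
    by (auto simp: disjnt_def)
  show thesis
  proof
    show "compact (- V)" using assms(1) compact_Int_closed[of UNIV "- V"] VW(1) by auto
    show "C \<subseteq> interior (- V)" using VW by (intro order_trans[OF VW(4)] interior_maximal) auto
  qed (use VW in auto)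
qed

text \<open>The use of saturation. The type consists of \<open>\<psi>(G')\<close> for all neighbourhood families \<open>G'\<close>; it is
  finitely consistent because finitely many families have a common refinement and truth is monotone
  in the sets. The values of the variables in \<open>I\<close> and \<open>J\<close> are retained without substituting into
  \<open>\<psi>\<close>: a home value is fixed by an equation with a parameter, and a value \<open>\<alpha>\<close> in \<open>S\<close> by \<open>\<xi> \<in> {\<alpha>}\<close>,
  as singletons are compact.\<close>

lemma saturated_realizes_nbhds:
  fixes U :: "('f, 'r, 'g, 'h, 's::t2_space) two_sorted"
    and \<psi> :: "('f, 'r, 'g, 'h, 's, nat) fm"
  assumes S: "compact (UNIV :: 's set)" and sat: "F_saturated L U" and inf: "infinite (UNIV :: 'h set)"
    and wf: "wf_fm L \<psi>" and par: "finite (fm_params \<psi>)"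
    and fin: "finite I" "finite J"
    and ex: "\<And>G'. nbhd_family (fm_sets \<psi>) G G' \<Longrightarrow>
      \<exists>v' e'. (\<forall>i\<in>I. v' i = v i) \<and> (\<forall>j\<in>J. e' j = e j) \<and> sat U v' e' (subst_sets G' \<psi>)"
  obtains v' e' where "\<forall>i\<in>I. v' i = v i" "\<forall>j\<in>J. e' j = e j"
    "\<And>G'. nbhd_family (fm_sets \<psi>) G G' \<Longrightarrow> sat U v' e' (subst_sets G' \<psi>)"
proof -
  define pI :: "('f, 'r, 'g, 'h, 's, 's set) fm set"
    where "pI = (\<lambda>i. Pos (Eq (HVar i) (HParam (v i)))) ` I"
  define pJ :: "('f, 'r, 'g, 'h, 's, 's set) fm set"
    where "pJ = (\<lambda>j. Mem (SVar j) {e j}) ` J"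
  define NB where "NB = {G'. nbhd_family (fm_sets \<psi>) G G'}"
  define p where "p = pI \<union> pJ \<union> (\<lambda>G'. subst_sets G' \<psi>) ` NB"
  define A where "A = fm_params \<psi> \<union> v ` I"
  have "|A| <o |UNIV :: 'h set|"
    using par fin inf by (intro finite_ordLess_infinite) (auto simp: A_def Field_card_of card_of_well_order_on)
  moreover have "p \<subseteq> F_formulas L A"
    using wf by (auto simp: p_def pI_def pJ_def NB_def A_def F_formulas_def nbhd_family_def)
  moreover have "finite (\<Union>\<theta>\<in>p. hfv \<theta>)"
    by (rule finite_subset[of _ "I \<union> hfv \<psi>"])
      (auto simp: p_def pI_def pJ_def fin finite_hfv)
  moreover have "finite (\<Union>\<theta>\<in>p. sfv \<theta>)"
    by (rule finite_subset[of _ "J \<union> sfv \<psi>"])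
      (auto simp: p_def pI_def pJ_def fin finite_sfv)
  moreover have "\<exists>v e. \<forall>\<theta>\<in>q. sat U v e \<theta>" if "q \<subseteq> p" "finite q" for q
  proof -
    have "finite (q \<inter> (\<lambda>G'. subst_sets G' \<psi>) ` NB)" using that by auto
    then obtain Q where Q: "Q \<subseteq> NB" "finite Q"
      "q \<inter> (\<lambda>G'. subst_sets G' \<psi>) ` NB = (\<lambda>G'. subst_sets G' \<psi>) ` Q"
      by (meson finite_subset_image inf_le2)
    have "nbhd_family (fm_sets \<psi>) G (\<lambda>i. \<Inter>G'\<in>Q. G' i)"
      using S Q by (intro nbhd_family_Inter) (auto simp: NB_def)
    from ex[OF this] obtain v' e' where ve: "\<forall>i\<in>I. v' i = v i" "\<forall>j\<in>J. e' j = e j"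
      "sat U v' e' (subst_sets (\<lambda>i. \<Inter>G'\<in>Q. G' i) \<psi>)" by blast
    have *: "sat U v' e' (subst_sets G' \<psi>)" if "G' \<in> Q" for G'
      by (rule sat_mono[OF _ ve(3)]) (use that in auto)
    have "sat U v' e' \<theta>" if "\<theta> \<in> q" for \<theta>
    proof (cases "\<theta> \<in> pI \<union> pJ")
      case True
      then show ?thesis using ve(1,2) by (auto simp: pI_def pJ_def)
    next
      case False
      then have "\<theta> \<in> q \<inter> (\<lambda>G'. subst_sets G' \<psi>) ` NB"
        using \<open>\<theta> \<in> q\<close> \<open>q \<subseteq> p\<close> by (auto simp: p_def)
      then have "\<theta> \<in> (\<lambda>G'. subst_sets G' \<psi>) ` Q" by (simp only: Q(3))
      then show ?thesis using * by auto
    qed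
    then show ?thesis by blast
  qed
  ultimately have "\<exists>v e. \<forall>\<theta>\<in>p. sat U v e \<theta>"
    using sat unfolding F_saturated_def by blast
  then obtain v' e' where all: "\<And>\<theta>. \<theta> \<in> p \<Longrightarrow> sat U v' e' \<theta>" by blast
  show thesis
  proof
    show "\<forall>i\<in>I. v' i = v i"
    proof
      fix i assume "i \<in> I"
      then have "sat U v' e' (Pos (Eq (HVar i) (HParam (v i))))" by (intro all) (auto simp: p_def pI_def)
      then show "v' i = v i" by simp
    qed
    show "\<forall>j\<in>J. e' j = e j"
    proof
      fix j assume "j \<in> J"
      then have "sat U v' e' (Mem (SVar j) {e j})" by (intro all) (auto simp: p_def pJ_def)
      then show "e' j = e j" by simp
    qed
    show "sat U v' e' (subst_sets G' \<psi>)" if "nbhd_family (fm_sets \<psi>) G G'" for G'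
      using that by (intro all) (auto simp: p_def NB_def)
  qed
qed

text \<open>For an atom \<open>\<tau> \<in> X\<close> this holds because a compact set is the intersection of its compact
  neighbourhoods. An existential quantifier requires one witness that serves for all neighbourhood
  families at once, and saturation provides it. The other steps are direct, disjunction by
  intersecting two neighbourhoods.\<close>

lemma sat_if_sat_nbhds:
  fixes U :: "('f, 'r, 'g, 'h, 's::t2_space) two_sorted"
    and \<phi> :: "('f, 'r, 'g, 'h, 's, nat) fm"
  assumes S: "compact (UNIV :: 's set)" and sat: "F_saturated L U" and inf: "infinite (UNIV :: 'h set)"
  shows "wf_fm L \<phi> \<Longrightarrow> finite (fm_params \<phi>) \<Longrightarrow> (\<And>i. i \<in> fm_sets \<phi> \<Longrightarrow> compact (G i)) \<Longrightarrow>
    (\<And>G'. nbhd_family (fm_sets \<phi>) G G' \<Longrightarrow> sat U v e (subst_sets G' \<phi>)) \<Longrightarrow>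
    sat U v e (subst_sets G \<phi>)"
proof (induction \<phi> arbitrary: v e)
  case (Pos A)
  have "nbhd_family (fm_sets (Pos A)) G G" by (simp add: nbhd_family_def)
  from Pos.prems(4)[OF this] show ?case .
next
  case (Neg A)
  have "nbhd_family (fm_sets (Neg A)) G G" by (simp add: nbhd_family_def)
  from Neg.prems(4)[OF this] show ?case .
next
  case (Mem t X)
  show ?case
  proof (rule ccontr)
    assume "\<not> ?thesis"
    then have "seval U v e t \<notin> G X" by simp
    with Mem.prems obtain K where K: "compact K" "G X \<subseteq> interior K" "seval U v e t \<notin> K"
      using compact_nbhd_avoiding_point[OF S, of "G X"] by auto
    have "sat U v e (subst_sets (\<lambda>_. K) (Mem t X))"
      using K by (intro Mem.prems) (simp add: nbhd_family_def)
    with K show False by simp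
  qed
next
  case (And \<phi> \<psi>)
  \<comment> \<open>The hypothesis speaks of families for both conjuncts; a family for one is completed by \<open>UNIV\<close>,
    which is a compact neighbourhood of everything.\<close>
  define ext where "ext G' I = (\<lambda>i. if i \<in> I then G' i else UNIV)" for G' :: "nat \<Rightarrow> 's set" and I
  have ext: "nbhd_family K G (ext G' I)" if "nbhd_family I G G'" for G' I K
    using that S by (auto simp: nbhd_family_def ext_def)
  have "sat U v e (subst_sets G' \<phi>)" if "nbhd_family (fm_sets \<phi>) G G'" for G'
    using sat_mono[of \<phi> "ext G' (fm_sets \<phi>)" G' U v e] And.prems(4)[OF ext[OF that]]
    by (auto simp: ext_def)
  moreover have "sat U v e (subst_sets G' \<psi>)" if "nbhd_family (fm_sets \<psi>) G G'" for G'
    using sat_mono[of \<psi> "ext G' (fm_sets \<psi>)" G' U v e] And.prems(4)[OF ext[OF that]]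
    by (auto simp: ext_def)
  ultimately show ?case using And.IH[of v e] And.prems(1-3) by simp
next
  case (Or \<phi> \<psi>)
  show ?case
  proof (rule ccontr)
    assume n: "\<not> ?thesis"
    obtain G1 where G1: "nbhd_family (fm_sets \<phi>) G G1" "\<not> sat U v e (subst_sets G1 \<phi>)"
      using Or.IH(1)[of v e] Or.prems(1-3) n by auto
    obtain G2 where G2: "nbhd_family (fm_sets \<psi>) G G2" "\<not> sat U v e (subst_sets G2 \<psi>)"
      using Or.IH(2)[of v e] Or.prems(1-3) n by auto
    define H where "H i = (if i \<in> fm_sets \<phi> then if i \<in> fm_sets \<psi> then G1 i \<inter> G2 i else G1 i else G2 i)"
      for i
    have "nbhd_family (fm_sets (Or \<phi> \<psi>)) G H"
      using G1(1) G2(1) by (auto simp: nbhd_family_def H_def interior_Int compact_Int)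
    from Or.prems(4)[OF this] have "sat U v e (subst_sets H \<phi>) \<or> sat U v e (subst_sets H \<psi>)"
      by simp
    moreover have "\<not> sat U v e (subst_sets H \<phi>)"
    proof
      assume "sat U v e (subst_sets H \<phi>)"
      then have "sat U v e (subst_sets G1 \<phi>)" by (rule sat_mono[rotated]) (simp add: H_def)
      with G1(2) show False ..
    qed
    moreover have "\<not> sat U v e (subst_sets H \<psi>)"
    proof
      assume "sat U v e (subst_sets H \<psi>)"
      then have "sat U v e (subst_sets G2 \<psi>)" by (rule sat_mono[rotated]) (simp add: H_def)
      with G2(2) show False ..
    qed
    ultimately show False by blast
  qed
next
  case (AllH i \<phi>)
  then show ?case by simp
next
  case (AllS i \<phi>)
  then show ?case by simp
next
  case (ExH i \<phi>)
  have "\<exists>v' e'. (\<forall>k\<in>hfv \<phi> - {i}. v' k = v k) \<and> (\<forall>k\<in>sfv \<phi>. e' k = e k) \<and>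
      sat U v' e' (subst_sets G' \<phi>)" if G': "nbhd_family (fm_sets \<phi>) G G'" for G'
  proof -
    obtain a where "sat U (v(i := a)) e (subst_sets G' \<phi>)" using ExH.prems(4)[of G'] G' by auto
    then show ?thesis by (intro exI[of _ "v(i := a)"] exI[of _ e]) auto
  qed
  then obtain v' e' where ve: "\<forall>k\<in>hfv \<phi> - {i}. v' k = v k" "\<forall>k\<in>sfv \<phi>. e' k = e k"
    "\<And>G'. nbhd_family (fm_sets \<phi>) G G' \<Longrightarrow> sat U v' e' (subst_sets G' \<phi>)"
    by (rule saturated_realizes_nbhds[OF S sat inf, of \<phi> "hfv \<phi> - {i}" "sfv \<phi>" G v e, rotated 4])
      (use ExH.prems(1,2) in \<open>auto simp: finite_hfv finite_sfv\<close>)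
  have "sat U (v(i := v' i)) e (subst_sets G' \<phi>)" if "nbhd_family (fm_sets \<phi>) G G'" for G'
    using ve(3)[OF that] ve(1,2) sat_cong[of "subst_sets G' \<phi>" v' "v(i := v' i)" e' e U] by auto
  then have "sat U (v(i := v' i)) e (subst_sets G \<phi>)" using ExH.IH ExH.prems(1-3) by auto
  then show ?case by auto
next
  case (ExS i \<phi>)
  have "\<exists>v' e'. (\<forall>k\<in>hfv \<phi>. v' k = v k) \<and> (\<forall>k\<in>sfv \<phi> - {i}. e' k = e k) \<and>
      sat U v' e' (subst_sets G' \<phi>)" if G': "nbhd_family (fm_sets \<phi>) G G'" for G'
  proof -
    obtain a where "sat U v (e(i := a)) (subst_sets G' \<phi>)" using ExS.prems(4)[of G'] G' by auto
    then show ?thesis by (intro exI[of _ v] exI[of _ "e(i := a)"]) auto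
  qed
  then obtain v' e' where ve: "\<forall>k\<in>hfv \<phi>. v' k = v k" "\<forall>k\<in>sfv \<phi> - {i}. e' k = e k"
    "\<And>G'. nbhd_family (fm_sets \<phi>) G G' \<Longrightarrow> sat U v' e' (subst_sets G' \<phi>)"
    by (rule saturated_realizes_nbhds[OF S sat inf, of \<phi> "hfv \<phi>" "sfv \<phi> - {i}" G v e, rotated 4])
      (use ExS.prems(1,2) in \<open>auto simp: finite_hfv finite_sfv\<close>)
  have "sat U v (e(i := e' i)) (subst_sets G' \<phi>)" if "nbhd_family (fm_sets \<phi>) G G'" for G'
    using ve(3)[OF that] ve(1,2) sat_cong[of "subst_sets G' \<phi>" v' v e' "e(i := e' i)" U] by auto
  then have "sat U v (e(i := e' i)) (subst_sets G \<phi>)" using ExS.IH ExS.prems(1-3) by auto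
  then show ?case by auto
qed

section \<open>From falsity to the pseudonegation\<close>

text \<open>If \<open>\<phi>\<close> fails for \<open>G\<close>, it fails for some neighbourhoods \<open>G'\<close>. The complements of the interiors of
  \<open>G'\<close> are disjoint from \<open>G\<close>, and together with \<open>G'\<close> they cover \<open>S\<close>.\<close>

lemma sat_pneg_disjoint:
  fixes U :: "('f, 'r, 'g, 'h, 's::t2_space) two_sorted"
    and \<phi> :: "('f, 'r, 'g, 'h, 's, nat) fm"
  assumes S: "compact (UNIV :: 's set)" and "F_saturated L U" and "infinite (UNIV :: 'h set)"
    and "wf_fm L \<phi>" "finite (fm_params \<phi>)" "\<And>i. i \<in> fm_sets \<phi> \<Longrightarrow> compact (G i)"
    and "\<not> sat U v e (subst_sets G \<phi>)"
  obtains H where "\<And>i. i \<in> fm_sets \<phi> \<Longrightarrow> compact (H i) \<and> G i \<inter> H i = {}"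
    "sat U v e (subst_sets H (pneg \<phi>))"
proof -
  obtain G' where G': "nbhd_family (fm_sets \<phi>) G G'" "\<not> sat U v e (subst_sets G' \<phi>)"
    using sat_if_sat_nbhds[OF assms(1-3), of \<phi> G v e] assms by blast
  define H where "H i = - interior (G' i)" for i
  have "compact (H i)" for i
    using S compact_Int_closed[of UNIV "H i"] by (simp add: H_def closed_Compl)
  moreover have "G i \<inter> H i = {}" if "i \<in> fm_sets \<phi>" for i
    using G'(1) that by (auto simp: nbhd_family_def H_def)
  moreover have "sat U v e (subst_sets H (pneg \<phi>))"
    by (rule sat_pneg_if_covers[OF _ G'(2)]) (use interior_subset in \<open>auto simp: H_def\<close>)
  ultimately show thesis using that by blast
qed

lemma holds_pneg_disjoint:
  fixes U :: "('f, 'r, 'g, 'h, 's::t2_space) two_sorted"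
  assumes S: "compact (UNIV :: 's set)" and "F_saturated L U" and "infinite (UNIV :: 'h set)"
    and "\<phi> \<in> FX_formulas L {} N" "C \<in> compact_tuples N" "\<not> holds U xs zs \<phi> a b C"
  obtains D where "D \<in> compact_tuples N" "disjoint_tuples C D" "holds U xs zs (pneg \<phi>) a b D"
proof -
  have len: "length C = N" and cpt: "\<And>i. i < N \<Longrightarrow> compact (C ! i)"
    using assms(5) by (auto simp: compact_tuples_def)
  have wf: "wf_fm L \<phi>" "finite (fm_params \<phi>)" "fm_sets \<phi> \<subseteq> {..<N}"
    using assms(4) by (auto simp: FX_formulas_def)
  obtain H where H: "\<And>i. i \<in> fm_sets \<phi> \<Longrightarrow> compact (H i) \<and> C ! i \<inter> H i = {}"
    "sat U (\<lambda>i. the (map_of (zip (xs @ zs) (a @ b)) i)) (\<lambda>_. undefined) (subst_sets H (pneg \<phi>))"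
    by (rule sat_pneg_disjoint[OF assms(1-3) wf(1,2), of "(!) C"])
      (use assms(6) cpt wf(3) in \<open>auto simp: holds_def inst_eq\<close>)
  \<comment> \<open>\<open>H\<close> is controlled only at the indices that occur in \<open>\<phi>\<close>; the other entries of \<open>D\<close> are chosen so
    as to be compact and disjoint from everything.\<close>
  define D where "D = map (\<lambda>i. if i \<in> fm_sets \<phi> then H i else {}) [0..<N]"
  have nth: "D ! i = H i" if "i \<in> fm_sets \<phi>" for i
    using that wf(3) by (auto simp: D_def)
  show thesis
  proof
    show "D \<in> compact_tuples N" using H(1) by (auto simp: D_def compact_tuples_def)
    show "disjoint_tuples C D"
      using H(1) len by (auto simp: D_def disjoint_tuples_def list_all2_conv_all_nth)
    show "holds U xs zs (pneg \<phi>) a b D"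
      unfolding holds_def inst_eq
      by (rule sat_mono[OF _ H(2)]) (simp add: nth)
  qed
qed

lemma holds_mono:
  assumes "list_all2 (\<subseteq>) C D" "fm_sets \<phi> \<subseteq> {..<length C}" "holds M xs zs \<phi> a b C"
  shows "holds M xs zs \<phi> a b D"
  using assms(3) unfolding holds_def inst_eq
  by (rule sat_mono[rotated]) (use assms(1,2) in \<open>fastforce simp: list_all2_conv_all_nth\<close>)

lemma compact_Image:
  fixes \<epsilon> :: "('a::t2_space \<times> 'b::t2_space) set"
  assumes "compact (UNIV :: 'b set)" "compact \<epsilon>" "compact C"
  shows "compact (\<epsilon> `` C)"
proof -
  have "\<epsilon> `` C = snd ` (\<epsilon> \<inter> C \<times> UNIV)" by force
  then show ?thesis
    using assms by (auto intro!: compact_continuous_image compact_Int compact_Times continuous_intros)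
qed

lemma enlarge_compact_tuples:
  fixes \<epsilon> :: "('s::t2_space \<times> 's) set"
  assumes "compact (UNIV :: 's set)" "compact \<epsilon>" "C \<in> compact_tuples N"
  shows "enlarge \<epsilon> C \<in> compact_tuples N"
  using assms by (auto simp: enlarge_def compact_tuples_def intro: compact_Image)

text \<open>Instability requires sets \<open>C'\<^sub>n\<close> that serve against all \<open>a\<^sub>i\<close> with \<open>i < n\<close> simultaneously. The
  finitely many sets obtained for the individual \<open>i\<close> are united, which preserves compactness,
  disjointness from \<open>C\<^sub>n\<^sup>\<epsilon>\<close>, and the truth of \<open>\<sim>\<phi>\<close>.\<close>

lemma unstable_if_ladders:
  fixes U :: "('f, 'r, 'g, 'h, 's::t2_space) two_sorted"
  assumes S: "compact (UNIV :: 's set)" and sat: "F_saturated L U" and inf: "infinite (UNIV :: 'h set)"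
    and \<epsilon>: "compact \<epsilon>" and \<phi>: "\<phi> \<in> FX_formulas L {} N"
    and ladder: "\<And>m::nat. \<exists>a b C.
      (\<forall>i<m. a i \<in> tuples (length xs) \<and> b i \<in> tuples (length zs) \<and> C i \<in> compact_tuples N) \<and>
      (\<forall>n<m. \<forall>i<n. holds U xs zs \<phi> (a n) (b i) (C i) \<and> \<not> holds U xs zs \<phi> (a i) (b n) (enlarge \<epsilon> (C n)))"
  shows "unstable U xs zs N \<phi> \<epsilon>"
  unfolding unstable_def
proof
  fix m :: nat
  obtain a b C where
    in_tuples: "\<And>i. i < m \<Longrightarrow> a i \<in> tuples (length xs) \<and> b i \<in> tuples (length zs) \<and> C i \<in> compact_tuples N"
    and edge: "\<And>n i. n < m \<Longrightarrow> i < n \<Longrightarrow> holds U xs zs \<phi> (a n) (b i) (C i)"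
    and nonedge: "\<And>n i. n < m \<Longrightarrow> i < n \<Longrightarrow> \<not> holds U xs zs \<phi> (a i) (b n) (enlarge \<epsilon> (C n))"
    using ladder[of m] by blast
  have "\<exists>D. D \<in> compact_tuples N \<and> disjoint_tuples (enlarge \<epsilon> (C n)) D \<and>
      holds U xs zs (pneg \<phi>) (a i) (b n) D" if "n < m" "i < n" for n i
    using holds_pneg_disjoint[OF S sat inf \<phi> _ nonedge[OF that]]
      enlarge_compact_tuples[OF S \<epsilon>] in_tuples[OF that(1)] by metis
  then obtain D where D: "\<And>n i. n < m \<Longrightarrow> i < n \<Longrightarrow> D n i \<in> compact_tuples N \<and>
      disjoint_tuples (enlarge \<epsilon> (C n)) (D n i) \<and> holds U xs zs (pneg \<phi>) (a i) (b n) (D n i)"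
    by metis
  define C' where "C' n = map (\<lambda>l. \<Union>i<n. D n i ! l) [0..<N]" for n
  have "C' n \<in> compact_tuples N" if "n < m" for n
    using D[OF that] by (auto simp: C'_def compact_tuples_def)
  moreover have "disjoint_tuples (enlarge \<epsilon> (C n)) (C' n)" if "n < m" for n
  proof -
    have len: "length (enlarge \<epsilon> (C n)) = N"
      using in_tuples[OF that] by (simp add: compact_tuples_def enlarge_def)
    have "enlarge \<epsilon> (C n) ! l \<inter> D n i ! l = {}" if "l < N" "i < n" for l i
      using D[OF \<open>n < m\<close> that(2)] that(1) len
      by (simp add: disjoint_tuples_def list_all2_conv_all_nth)
    then have "enlarge \<epsilon> (C n) ! l \<inter> (\<Union>i<n. D n i ! l) = {}" if "l < N" for l
      using that by blast
    then show ?thesis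
      using len by (simp add: disjoint_tuples_def list_all2_conv_all_nth C'_def)
  qed
  moreover have "holds U xs zs (pneg \<phi>) (a i) (b n) (C' n)" if "n < m" "i < n" for n i
    using D[OF that] that(2) \<phi>
    by (intro holds_mono[of "D n i" "C' n"])
      (auto simp: C'_def list_all2_conv_all_nth compact_tuples_def FX_formulas_def)
  ultimately show "\<exists>a b C C'.
      (\<forall>i<m. a i \<in> tuples (length xs) \<and> b i \<in> tuples (length zs) \<and>
        C i \<in> compact_tuples N \<and> C' i \<in> compact_tuples N) \<and>
      (\<forall>n<m. \<forall>i<n. holds U xs zs \<phi> (a n) (b i) (C i) \<and>
        holds U xs zs (pneg \<phi>) (a i) (b n) (C' n) \<and>
        disjoint_tuples (enlarge \<epsilon> (C i)) (C' i))"
    using in_tuples edge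
    by (intro exI[of _ a] exI[of _ b] exI[of _ C] exI[of _ C']) auto
qed

section \<open>Ladders and majority votes\<close>

text \<open>Two relations are used in place of one and its negation, so that the two orientations of a ladder
  are exchanged by swapping the relations.\<close>

definition has_ladder :: "'a set \<Rightarrow> 'y set \<Rightarrow> ('a \<Rightarrow> 'y \<Rightarrow> bool) \<Rightarrow> ('a \<Rightarrow> 'y \<Rightarrow> bool) \<Rightarrow> nat \<Rightarrow> bool" where
  "has_ladder X Y P Q N \<longleftrightarrow> (\<exists>a y. (\<forall>i<N. a i \<in> X \<and> y i \<in> Y) \<and>
    (\<forall>n<N. \<forall>i<n. P (a n) (y i) \<and> Q (a i) (y n)))"

text \<open>Both sequences are read backwards.\<close>

lemma has_ladder_swap: "has_ladder X Y Q P N \<Longrightarrow> has_ladder X Y P Q N"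
proof -
  assume "has_ladder X Y Q P N"
  then obtain a y where *: "\<And>i. i < N \<Longrightarrow> a i \<in> X \<and> y i \<in> Y"
    "\<And>n i. n < N \<Longrightarrow> i < n \<Longrightarrow> Q (a n) (y i) \<and> P (a i) (y n)"
    unfolding has_ladder_def by blast
  show ?thesis
    unfolding has_ladder_def
    using * by (intro exI[of _ "\<lambda>i. a (N - 1 - i)"] exI[of _ "\<lambda>i. y (N - 1 - i)"]) auto
qed

text \<open>The value depends on the set \<open>W\<close> only, so that elements chosen after those in \<open>W\<close> can be chosen
  with regard to it. It is arbitrary if there is no such \<open>y\<close>, whence the guards in the lemmas below.\<close>

definition witness :: "'y set \<Rightarrow> ('a \<Rightarrow> 'y \<Rightarrow> bool) \<Rightarrow> ('y \<Rightarrow> bool) \<Rightarrow> 'a set \<Rightarrow> 'y" where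
  "witness Y P E W = (SOME y. y \<in> Y \<and> E y \<and> (\<forall>a\<in>W. P a y))"

lemma witness:
  assumes "y \<in> Y" "E y" "\<forall>a\<in>W. P a y"
  shows "witness Y P E W \<in> Y \<and> E (witness Y P E W) \<and> (\<forall>a\<in>W. P a (witness Y P E W))"
  unfolding witness_def by (rule someI[of _ y]) (use assms in blast)

text \<open>The point \<open>y\<close> shows that witnesses exist for all sets of elements indexed by \<open>w\<close>. Enumerate \<open>w\<close>
  increasingly and take the witnesses for its initial segments: an element in the initial segment is
  in relation \<open>P\<close> to the witness by choice of the witness, and a later one is in relation \<open>Q\<close> to it
  because the element was chosen when the witness was already fixed.\<close>

lemma ladder_if_witness:
  fixes a :: "nat \<Rightarrow> 'a"
  assumes X: "\<And>n. a n \<in> X"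
    and step: "\<And>n W. W \<subseteq> a ` {..<n} \<Longrightarrow> witness Y P E W \<in> Y \<Longrightarrow> E (witness Y P E W) \<Longrightarrow>
      Q (a n) (witness Y P E W)"
    and w: "finite w" "card w = N" and y: "y \<in> Y" "E y" "\<forall>i\<in>w. P (a i) y"
  shows "has_ladder X Y Q P N"
proof -
  define s where "s = (!) (sorted_list_of_set w)"
  have s: "s i \<in> w" if "i < N" for i
    using that w by (metis s_def nth_mem set_sorted_list_of_set sorted_list_of_set.length_sorted_key_list_of_set)
  have mono: "s i < s j" if "i < j" "j < N" for i j
    using that w strict_sorted_list_of_set[of w] by (auto simp: s_def sorted_wrt_iff_nth_less)
  define W where "W j = (\<lambda>l. a (s l)) ` {..j}" for j
  have wit: "witness Y P E (W j) \<in> Y \<and> E (witness Y P E (W j)) \<and> (\<forall>a\<in>W j. P a (witness Y P E (W j)))"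
    if "j < N" for j
    using y s that by (intro witness) (auto simp: W_def)
  have "Q (a (s n)) (witness Y P E (W i))" if "n < N" "i < n" for n i
  proof (rule step)
    show "W i \<subseteq> a ` {..<s n}" using mono that by (fastforce simp: W_def)
  qed (use wit[of i] that in auto)
  moreover have "P (a (s i)) (witness Y P E (W n))" if "n < N" "i < n" for n i
    using wit[of n] that by (auto simp: W_def)
  ultimately show ?thesis
    unfolding has_ladder_def using X wit
    by (intro exI[of _ "\<lambda>i. a (s i)"] exI[of _ "\<lambda>j. witness Y P E (W j)"]) auto
qed

text \<open>If \<open>N\<close> voters accepted a \<open>y\<close> with \<open>plus y \<notin> D\<close>, or rejected \<open>plus y\<close> for some \<open>y \<in> D\<close>, the
  witnesses would form a ladder, in opposite orientations in the two cases. So for \<open>y \<in> D\<close> fewer than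
  \<open>N\<close> of the \<open>2 * N\<close> voters reject \<open>plus y\<close>, and at least \<open>N\<close> accept it.\<close>

lemma majority_approximates:
  fixes P :: "'a \<Rightarrow> 'y \<Rightarrow> bool" and plus :: "'y \<Rightarrow> 'y"
  assumes approx: "\<And>B. finite B \<Longrightarrow> B \<subseteq> Y \<Longrightarrow> \<exists>a\<in>X. \<forall>y\<in>B. y \<in> D \<longleftrightarrow> P a y"
    and plus: "\<And>y. y \<in> Y \<Longrightarrow> plus y \<in> Y"
    and no_ladder: "\<not> has_ladder X Y P (\<lambda>a y. \<not> P a (plus y)) N"
  shows "\<exists>a :: nat \<Rightarrow> 'a. (\<forall>n. a n \<in> X) \<and> (\<forall>y\<in>Y.
    (y \<in> D \<longrightarrow> (\<exists>w\<subseteq>{..<2 * N}. card w = N \<and> (\<forall>i\<in>w. P (a i) (plus y)))) \<and>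
    ((\<exists>w\<subseteq>{..<2 * N}. card w = N \<and> (\<forall>i\<in>w. P (a i) y)) \<longrightarrow> plus y \<in> D))"
proof -
  let ?Q = "\<lambda>a y. \<not> P a (plus y)"
  let ?c = "witness Y P (\<lambda>y. plus y \<notin> D)" and ?d = "witness Y ?Q (\<lambda>y. y \<in> D)"
  \<comment> \<open>A condition on \<open>r\<close> as the choice at stage \<open>n\<close>, when the elements \<open>f 0, \<dots>, f (n - 1)\<close> have been
    chosen.\<close>
  define good where "good f n r \<longleftrightarrow> r \<in> X \<and> (\<forall>W\<subseteq>f ` {..<n}.
      (?c W \<in> Y \<longrightarrow> plus (?c W) \<notin> D \<longrightarrow> ?Q r (?c W)) \<and> (?d W \<in> Y \<longrightarrow> ?d W \<in> D \<longrightarrow> P r (?d W)))"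
    for f :: "nat \<Rightarrow> 'a" and n r
  have "\<exists>a. \<forall>n. good a n (a n)"
  proof (rule dependent_wellorder_choice)
    fix r :: 'a and f g :: "nat \<Rightarrow> 'a" and n :: nat
    assume "\<And>m. m < n \<Longrightarrow> f m = g m"
    then have "f ` {..<n} = g ` {..<n}" by auto
    then show "good f n r = good g n r" by (simp only: good_def)
  next
    fix n :: nat and f :: "nat \<Rightarrow> 'a"
    let ?B = "((plus \<circ> ?c) ` Pow (f ` {..<n}) \<union> ?d ` Pow (f ` {..<n})) \<inter> Y"
    have "\<exists>a\<in>X. \<forall>y\<in>?B. y \<in> D \<longleftrightarrow> P a y" by (rule approx) auto
    then obtain r where r: "r \<in> X" "\<forall>y\<in>?B. y \<in> D \<longleftrightarrow> P r y" by (rule bexE)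
    have "?Q r (?c W)" if "W \<subseteq> f ` {..<n}" "?c W \<in> Y" "plus (?c W) \<notin> D" for W
    proof -
      have "plus (?c W) \<in> ?B" using that plus by (simp add: image_iff) blast
      with r(2) that(3) show ?thesis by blast
    qed
    moreover have "P r (?d W)" if "W \<subseteq> f ` {..<n}" "?d W \<in> Y" "?d W \<in> D" for W
    proof -
      have "?d W \<in> ?B" using that by simp
      with r(2) that(3) show ?thesis by blast
    qed
    ultimately have "good f n r" using r(1) unfolding good_def by simp
    then show "\<exists>r. good f n r" by (rule exI)
  qed
  then obtain a where a: "\<And>n. good a n (a n)" by blast
  then have X: "\<And>n. a n \<in> X" by (simp add: good_def)
  have low: False if "y \<in> Y" "plus y \<notin> D" "finite w" "card w = N" "\<forall>i\<in>w. P (a i) y" for y w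
  proof -
    have "has_ladder X Y ?Q P N"
      by (rule ladder_if_witness[where a = a and X = X and Y = Y and P = P and Q = ?Q and E = "\<lambda>y. plus y \<notin> D", OF X _ that(3,4,1,2,5)])
        (use a in \<open>auto simp: good_def\<close>)
    with no_ladder show False using has_ladder_swap by blast
  qed
  have high: False if "y \<in> Y" "y \<in> D" "finite w" "card w = N" "\<forall>i\<in>w. ?Q (a i) y" for y w
  proof -
    have "has_ladder X Y P ?Q N"
      by (rule ladder_if_witness[where a = a and X = X and Y = Y and P = ?Q and Q = P and E = "\<lambda>y. y \<in> D", OF X _ that(3,4,1,2,5)])
        (use a in \<open>auto simp: good_def\<close>)
    with no_ladder show False by blast
  qed
  show ?thesis
  proof (intro exI[of _ a] conjI allI ballI impI)
    show "a n \<in> X" for n by (rule X)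
  next
    fix y
    assume "y \<in> Y" "\<exists>w\<subseteq>{..<2 * N}. card w = N \<and> (\<forall>i\<in>w. P (a i) y)"
    then show "plus y \<in> D" using low finite_subset[OF _ finite_lessThan] by blast
  next
    fix y
    assume y: "y \<in> Y" "y \<in> D"
    show "\<exists>w\<subseteq>{..<2 * N}. card w = N \<and> (\<forall>i\<in>w. P (a i) (plus y))"
    proof (rule ccontr)
      assume n: "\<not> ?thesis"
      define T where "T = {i\<in>{..<2 * N}. P (a i) (plus y)}"
      define F where "F = {i\<in>{..<2 * N}. \<not> P (a i) (plus y)}"
      have "\<not> N \<le> card T"
      proof
        assume "N \<le> card T"
        then obtain w where "w \<subseteq> T" "card w = N" using obtain_subset_with_card_n by metis
        with n show False unfolding T_def by blast
      qed
      moreover have "card T + card F = 2 * N"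
      proof -
        have "card (T \<union> F) = card T + card F"
          by (rule card_Un_disjoint) (auto simp: T_def F_def)
        moreover have "T \<union> F = {..<2 * N}" by (auto simp: T_def F_def)
        ultimately show ?thesis by simp
      qed
      ultimately have "N \<le> card F" by linarith
      then obtain w where "w \<subseteq> F" "card w = N" "finite w" using obtain_subset_with_card_n by metis
      with high[OF y] show False unfolding F_def by blast
    qed
  qed
qed

section \<open>Definability up to an entourage\<close>

theorem theorem31:
  fixes L :: "('f, 'r, 'g) language"
    and U :: "('f, 'r, 'g, 'h, 's::t2_space) two_sorted"
    and \<kappa> :: "'k rel"
    and \<epsilon> :: "('s \<times> 's) set"
    and xs zs :: "nat list"
    and N :: nat
    and \<phi> :: "('f, 'r, 'g, 'h, 's, nat) fm"
    and \<D> :: "('h list \<times> 's set list) set"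
  assumes "compact (UNIV :: 's set)"
    and "standard_structure L U"
    and "F_saturated L U"
    and "ramsey_cardinal \<kappa>"
    and "|symbols L :: ('f + 'r + 'g + 's set + nat \<times> ((nat \<Rightarrow> 's) \<Rightarrow> 's)) set| <o \<kappa>"
    and "|UNIV :: 'h set| =o \<kappa>"
    and "compact \<epsilon>" and "sym \<epsilon>" and "Id \<subseteq> interior \<epsilon>"
    and "distinct (xs @ zs)"
    and "\<phi> \<in> FX_formulas L {} N" and "hfv \<phi> \<subseteq> set (xs @ zs)" and "sfv \<phi> = {}"
    and "\<D> \<subseteq> tuples (length zs) \<times> compact_tuples N"
    and "\<not> unstable U xs zs N \<phi> \<epsilon>"
    and "approximable \<kappa> U xs zs N \<phi> \<D>"
  shows "\<exists>(k::nat) (m::nat) (a :: nat \<Rightarrow> nat \<Rightarrow> 'h list).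
    (\<forall>i<k. \<forall>j<m. a i j \<in> tuples (length xs)) \<and>
    (\<forall>b\<in>tuples (length zs). \<forall>C\<in>compact_tuples N.
      ((b, C) \<in> \<D> \<longrightarrow> (\<exists>i<k. \<forall>j<m. holds U xs zs \<phi> (a i j) b (enlarge \<epsilon> C))) \<and>
      ((\<exists>i<k. \<forall>j<m. holds U xs zs \<phi> (a i j) b C) \<longrightarrow> (b, enlarge \<epsilon> C) \<in> \<D>))"
proof -
  let ?X = "tuples (length xs) :: 'h list set"
  let ?Y = "tuples (length zs) \<times> compact_tuples N :: ('h list \<times> 's set list) set"
  let ?P = "\<lambda>a y. holds U xs zs \<phi> a (fst y) (snd y)"
  let ?plus = "\<lambda>y. (fst y, enlarge \<epsilon> (snd y))"
  have inf: "infinite (UNIV :: 'h set)" and fin_small: "\<And>B :: 'h list set. finite B \<Longrightarrow> |B| <o \<kappa>"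
  proof -
    have "natLeq <o \<kappa>" using assms(4) by (simp add: ramsey_cardinal_def)
    then have "natLeq <o |UNIV :: 'h set|"
      by (rule ordLess_ordIso_trans) (rule ordIso_symmetric[OF assms(6)])
    then show inf: "infinite (UNIV :: 'h set)"
      by (metis infinite_iff_natLeq_ordLeq ordLess_imp_ordLeq)
    show "|B| <o \<kappa>" if "finite B" for B :: "'h list set"
    proof (rule ordLess_ordIso_trans[OF _ assms(6)])
      show "|B| <o |UNIV :: 'h set|"
        using that inf
        by (intro finite_ordLess_infinite) (auto simp: Field_card_of card_of_well_order_on)
    qed
  qed
  have "\<exists>N0. \<not> has_ladder ?X ?Y ?P (\<lambda>a y. \<not> ?P a (?plus y)) N0"
  proof (rule ccontr)
    assume "\<not> ?thesis"
    then have lad: "has_ladder ?X ?Y ?P (\<lambda>a y. \<not> ?P a (?plus y)) m" for m by blast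
    have "unstable U xs zs N \<phi> \<epsilon>"
    proof (rule unstable_if_ladders[OF assms(1,3) inf assms(7,11)])
      fix m :: nat
      obtain a y where "\<forall>i<m. a i \<in> ?X \<and> y i \<in> ?Y"
        "\<forall>n<m. \<forall>i<n. ?P (a n) (y i) \<and> \<not> ?P (a i) (?plus (y n))"
        using lad[of m] unfolding has_ladder_def by blast
      then show "\<exists>a b C.
        (\<forall>i<m. a i \<in> tuples (length xs) \<and> b i \<in> tuples (length zs) \<and> C i \<in> compact_tuples N) \<and>
        (\<forall>n<m. \<forall>i<n. holds U xs zs \<phi> (a n) (b i) (C i) \<and>
          \<not> holds U xs zs \<phi> (a i) (b n) (enlarge \<epsilon> (C n)))"
        by (intro exI[of _ a] exI[of _ "fst \<circ> y"] exI[of _ "snd \<circ> y"]) (auto simp: mem_Times_iff)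
    qed
    with assms(15) show False by blast
  qed
  then obtain m where m: "\<not> has_ladder ?X ?Y ?P (\<lambda>a y. \<not> ?P a (?plus y)) m" by blast
  have approx: "\<exists>a\<in>?X. \<forall>y\<in>B. y \<in> \<D> \<longleftrightarrow> ?P a y" if "finite B" "B \<subseteq> ?Y" for B
  proof -
    have "fst ` B \<subseteq> tuples (length zs)" "|fst ` B| <o \<kappa>" using that fin_small by auto
    then obtain a where "a \<in> ?X"
      "\<forall>b\<in>fst ` B. \<forall>C\<in>compact_tuples N. (b, C) \<in> \<D> \<longleftrightarrow> holds U xs zs \<phi> a b C"
      using assms(16) unfolding approximable_def by blast
    then show ?thesis using that(2) by (intro bexI[of _ a]) fastforce+
  qed
  have plus: "?plus y \<in> ?Y" if "y \<in> ?Y" for y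
    using that enlarge_compact_tuples[OF assms(1,7)] by (auto simp: mem_Times_iff)
  obtain a :: "nat \<Rightarrow> 'h list" where aX: "\<forall>n. a n \<in> ?X" and a: "\<forall>y\<in>?Y.
    (y \<in> \<D> \<longrightarrow> (\<exists>w\<subseteq>{..<2 * m}. card w = m \<and> (\<forall>i\<in>w. ?P (a i) (?plus y)))) \<and>
    ((\<exists>w\<subseteq>{..<2 * m}. card w = m \<and> (\<forall>i\<in>w. ?P (a i) y)) \<longrightarrow> ?plus y \<in> \<D>)"
    using majority_approximates[where X = ?X and Y = ?Y and P = ?P and plus = ?plus and D = \<D>,
        OF approx plus m] by blast
  \<comment> \<open>The disjuncts are indexed by the \<open>m\<close>-element sets of voters, and the conjuncts by their members
    in increasing order.\<close>
  define Ws where "Ws = {w. w \<subseteq> {..<2 * m} \<and> card w = m}"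
  define l where "l w = sorted_list_of_set w" for w :: "nat set"
  have "finite Ws" unfolding Ws_def by simp
  then obtain h where h: "bij_betw h {..<card Ws} Ws"
    using ex_bij_betw_nat_finite lessThan_atLeast0 by metis
  have l: "(\<forall>j<m. R (a (l w ! j))) \<longleftrightarrow> (\<forall>i\<in>w. R (a i))" if "w \<in> Ws" for R w
  proof -
    have "finite w" using that finite_subset unfolding Ws_def by blast
    then have "set (l w) = w" "length (l w) = m" using that by (auto simp: l_def Ws_def)
    then show ?thesis by (metis in_set_conv_nth)
  qed
  have ex: "(\<exists>i<card Ws. \<forall>j<m. R (a (l (h i) ! j))) \<longleftrightarrow> (\<exists>w\<in>Ws. \<forall>i\<in>w. R (a i))" for R
  proof -
    have image: "h ` {..<card Ws} = Ws" using h by (simp add: bij_betw_def)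
    have "(\<exists>i<card Ws. \<forall>j<m. R (a (l (h i) ! j))) \<longleftrightarrow> (\<exists>w\<in>h ` {..<card Ws}. \<forall>j<m. R (a (l w ! j)))"
      by blast
    also have "\<dots> \<longleftrightarrow> (\<exists>w\<in>Ws. \<forall>i\<in>w. R (a i))"
      unfolding image by (intro bex_cong refl) (rule l)
    finally show ?thesis .
  qed
  show ?thesis
  proof (rule exI[of _ "card Ws"], rule exI[of _ m], rule exI[of _ "\<lambda>i j. a (l (h i) ! j)"],
      intro conjI ballI impI)
    show "\<forall>i<card Ws. \<forall>j<m. a (l (h i) ! j) \<in> ?X" using aX by blast
  next
    fix b C assume bC: "b \<in> tuples (length zs)" "C \<in> compact_tuples N" "(b, C) \<in> \<D>"
    then have "\<exists>w\<in>Ws. \<forall>i\<in>w. holds U xs zs \<phi> (a i) b (enlarge \<epsilon> C)"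
      using bspec[OF a, of "(b, C)"] by (auto simp: Ws_def)
    then show "\<exists>i<card Ws. \<forall>j<m. holds U xs zs \<phi> (a (l (h i) ! j)) b (enlarge \<epsilon> C)"
      by (simp only: ex[of "\<lambda>a. holds U xs zs \<phi> a b (enlarge \<epsilon> C)"])
  next
    fix b C assume bC: "b \<in> tuples (length zs)" "C \<in> compact_tuples N"
      "\<exists>i<card Ws. \<forall>j<m. holds U xs zs \<phi> (a (l (h i) ! j)) b C"
    then have "\<exists>w\<in>Ws. \<forall>i\<in>w. holds U xs zs \<phi> (a i) b C"
      by (simp only: ex[of "\<lambda>a. holds U xs zs \<phi> a b C"])
    then show "(b, enlarge \<epsilon> C) \<in> \<D>"
      using bspec[OF a, of "(b, C)"] bC(1,2) by (auto simp: Ws_def)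
  qed
qed

end
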